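(* Let $m,n,n_u,n_y$ be dimensions and let $\mathcal{T},\mathcal{A},\mathcal{B},\mathcal{C},\mathcal{K}$ be 4-PI operators with $$\mathcal{T},\mathcal{A}:\mathbb{R}L_2^{m,n}\to\mathbb{R}L_2^{m,n},\quad \mathcal{B}:\mathbb{R}^{n_u}\to\mathbb{R}L_2^{m,n},\quad \mathcal{C}:\mathbb{R}L_2^{m,n}\to\mathbb{R}^{n_y},\quad \mathcal{K}:\mathbb{R}L_2^{m,n}\to\mathbb{R}^{n_u}.$$ Suppose there exist a 4-PI operator $\mathcal{P}=\mathcal{P}^*\in\Pi_{n,n}^{m,m}$, matrices $F\in\mathbb{R}^{n_u\times n_u}$ and $Z\in\mathbb{R}^{n_u\times n_y}$, and constants $\alpha,\delta,\epsilon>0$ such that $\mathcal{P}\succcurlyeq\delta I$ and $\Phi+\Phi^*\preccurlyeq0$, where $\Phi$ is the operator on $\mathbb{R}^{n_u}\times\mathbb{R}L_2^{m,n}$ given by $$\Phi=\begin{bmatrix}-F+\frac{\epsilon}{2}I&\mathcal{B}^*\mathcal{P}\mathcal{T}+Z\mathcal{C}-F\mathcal{K}\\ 0&\mathcal{T}^*\mathcal{P}(\mathcal{A}+\mathcal{B}\mathcal{K}+\alpha\mathcal{T})\end{bmatrix}.$$ Then, if $L=F^{-1}Z$, the partial integral equation (PIE) $$\partial_t(\mathcal{T}\mathbf{x}(t))=(\mathcal{A}+\mathcal{B}L\mathcal{C})\mathbf{x}(t)$$ is exponentially stable with decay rate $\alpha$.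
   Context: $L_2^n[-1,0]$ is the space of Lebesgue square-integrable $\mathbb{R}^n$-valued functions on $[-1,0]$, and $\mathbb{R}L_2^{m,n}:=\mathbb{R}^m\times L_2^n[-1,0]$ with its natural Hilbert space inner product. 4-PI operators: $\Pi_{q,n}^{p,m}$ is the set of bounded linear operators $\mathcal{P}:\mathbb{R}L_2^{m,n}\to\mathbb{R}L_2^{p,q}$ of the form $$\Big(\mathcal{P}\begin{bmatrix}x\\ \mathbf{x}\end{bmatrix}\Big)(s)=\begin{bmatrix}Px+\int_{-1}^0Q_1(\theta)\mathbf{x}(\theta)\,d\theta\\ Q_2(s)x+R_0(s)\mathbf{x}(s)+\int_{-1}^sR_1(s,\theta)\mathbf{x}(\theta)\,d\theta+\int_s^0R_2(s,\theta)\mathbf{x}(\theta)\,d\theta\end{bmatrix},$$ where $P\in\mathbb{R}^{p\times m}$ is a matrix and $Q_1(s)\in\mathbb{R}^{p\times n}$, $Q_2(s)\in\mathbb{R}^{q\times m}$, $R_0(s),R_1(s,\theta),R_2(s,\theta)\in\mathbb{R}^{q\times n}$ are matrix-valued polynomials. Dimensions may be zero, in which case the corresponding parameters are absent (so operators from or into $\mathbb{R}^k=\mathbb{R}L_2^{k,0}$ are included). $^*$ denotes the Hilbert space adjoint. For self-adjoint $\mathcal{G}$, $\mathcal{G}\succcurlyeq0$ means $\langle\mathbf{x},\mathcal{G}\mathbf{x}\rangle\ge0$ for all $\mathbf{x}$; $\mathcal{G}\preccurlyeq0$ means $-\mathcal{G}\succcurlyeq0$; $\mathcal{P}\succcurlyeq\delta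 I$ means $\mathcal{P}-\delta I\succcurlyeq0$. A solution of a PIE $\partial_t(\mathcal{T}\mathbf{x}(t))=\mathcal{G}\mathbf{x}(t)$ is a function $\mathbf{x}:[0,\infty)\to\mathbb{R}L_2^{m,n}$ such that $t\mapsto\mathcal{T}\mathbf{x}(t)$ is differentiable and the equation holds for $t\ge0$. The PIE is exponentially stable with decay rate $\alpha>0$ if there is a constant $M$ such that for any initial state $\mathcal{T}\mathbf{x}(0)$, the solution $\mathbf{x}(t)$ satisfies $\|\mathcal{T}\mathbf{x}(t)\|_{\mathbb{R}L_2}\le M\|\mathcal{T}\mathbf{x}(0)\|_{\mathbb{R}L_2}e^{-\alpha t}$ for all $t\ge0$. *)

theory Defs
  imports
    "HOL-Analysis.Analysis"
    "HOL-Library.Type_Length"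
    "HOL-Computational_Algebra.Polynomial"
    "Jordan_Normal_Form.Gauss_Jordan_Elimination"
begin

section \<open>The Hilbert space of scalar square-integrable functions on [-1,0]\<close>

definition sq_integrable :: "(real \<Rightarrow> real) \<Rightarrow> bool" where
  "sq_integrable f \<longleftrightarrow> f \<in> borel_measurable (lebesgue_on {-1..0}) \<and>
     integrable (lebesgue_on {-1..0}) (\<lambda>s. (f s)\<^sup>2)"

definition l2_rel :: "(real \<Rightarrow> real) \<Rightarrow> (real \<Rightarrow> real) \<Rightarrow> bool" where
  "l2_rel f g \<longleftrightarrow> sq_integrable f \<and> sq_integrable g \<and> (AE s in lebesgue_on {-1..0}. f s = g s)"

lemma l2_rel_refl_iff: "l2_rel f f \<longleftrightarrow> sq_integrable f"
  by (simp add: l2_rel_def)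

lemma sq_integrable_zero: "sq_integrable (\<lambda>s. 0)"
  by (simp add: sq_integrable_def)

lemma part_equivp_l2_rel: "part_equivp l2_rel"
proof (rule part_equivpI)
  show "\<exists>f. l2_rel f f"
    using sq_integrable_zero by (auto simp: l2_rel_def)
  show "symp l2_rel"
    by (auto simp: symp_def l2_rel_def)
  show "transp l2_rel"
    unfolding transp_def l2_rel_def by (auto elim: eventually_elim2)
qed

lemma sq_integrable_times:
  assumes "sq_integrable f" "sq_integrable g"
  shows "integrable (lebesgue_on {-1..0}) (\<lambda>s. f s * g s)"
proof (rule Bochner_Integration.integrable_bound)
  show "integrable (lebesgue_on {-1..0}) (\<lambda>s. (f s)\<^sup>2 + (g s)\<^sup>2)"
    using assms by (simp add: sq_integrable_def)
  show "(\<lambda>s. f s * g s) \<in> borel_measurable (lebesgue_on {-1..0})"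
    using assms by (auto simp: sq_integrable_def intro: borel_measurable_times)
  have "\<bar>a * b\<bar> \<le> a\<^sup>2 + b\<^sup>2" for a b :: real
  proof -
    have "2 * (\<bar>a\<bar> * \<bar>b\<bar>) \<le> a\<^sup>2 + b\<^sup>2"
      using sum_squares_bound[of "\<bar>a\<bar>" "\<bar>b\<bar>"] by simp
    moreover have "0 \<le> \<bar>a\<bar> * \<bar>b\<bar>" by simp
    ultimately show ?thesis unfolding abs_mult by linarith
  qed
  then show "AE s in lebesgue_on {-1..0}. norm (f s * g s) \<le> norm ((f s)\<^sup>2 + (g s)\<^sup>2)"
    by simp
qed

lemma sq_integrable_add:
  assumes "sq_integrable f" "sq_integrable g"
  shows "sq_integrable (\<lambda>s. f s + g s)"
proof -
  have "integrable (lebesgue_on {-1..0}) (\<lambda>s. (f s)\<^sup>2 + (g s)\<^sup>2 + 2 * (f s * g s))"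
    using assms sq_integrable_times[OF assms] by (simp add: sq_integrable_def)
  then show ?thesis
    using assms by (auto simp: sq_integrable_def power2_sum mult.assoc intro: borel_measurable_add)
qed

lemma sq_integrable_scale:
  assumes "sq_integrable f"
  shows "sq_integrable (\<lambda>s. c * f s)"
  using assms
  by (auto simp: sq_integrable_def power_mult_distrib intro: borel_measurable_times)

quotient_type l2 = "real \<Rightarrow> real" / partial: l2_rel
  by (rule part_equivp_l2_rel)

instantiation l2 :: real_vector
begin

lift_definition zero_l2 :: l2 is "\<lambda>s. 0"
  by (simp add: l2_rel_refl_iff sq_integrable_zero)

lift_definition plus_l2 :: "l2 \<Rightarrow> l2 \<Rightarrow> l2" is "\<lambda>f g s. f s + g s"
  unfolding l2_rel_def by (auto intro: sq_integrable_add elim: eventually_elim2)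

lift_definition uminus_l2 :: "l2 \<Rightarrow> l2" is "\<lambda>f s. - f s"
  unfolding l2_rel_def using sq_integrable_scale[where c = "-1"] by auto

lift_definition scaleR_l2 :: "real \<Rightarrow> l2 \<Rightarrow> l2" is "\<lambda>c f s. c * f s"
  unfolding l2_rel_def by (auto intro: sq_integrable_scale)

definition minus_l2 :: "l2 \<Rightarrow> l2 \<Rightarrow> l2" where
  "minus_l2 f g = f + - g"

instance
proof
  fix a b c :: l2 and r q :: real
  show "a + b + c = a + (b + c)"
    by transfer (auto simp: l2_rel_def add.assoc intro!: sq_integrable_add)
  show "a + b = b + a"
    by transfer (auto simp: l2_rel_def add.commute intro!: sq_integrable_add)
  show "0 + a = a"
    by transfer (auto simp: l2_rel_def)
  show "- a + a = 0"
    by transfer (auto simp: l2_rel_def sq_integrable_zero)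
  show "a - b = a + - b"
    by (rule minus_l2_def)
  show "r *\<^sub>R (a + b) = r *\<^sub>R a + r *\<^sub>R b"
    by transfer (auto simp: l2_rel_def distrib_left intro!: sq_integrable_add sq_integrable_scale)
  show "(r + q) *\<^sub>R a = r *\<^sub>R a + q *\<^sub>R a"
    by transfer (auto simp: l2_rel_def distrib_right intro!: sq_integrable_add sq_integrable_scale)
  show "r *\<^sub>R q *\<^sub>R a = (r * q) *\<^sub>R a"
    by transfer (auto simp: l2_rel_def mult.assoc intro!: sq_integrable_scale)
  show "1 *\<^sub>R a = a"
    by transfer (auto simp: l2_rel_def)
qed

end

instantiation l2 :: real_inner
begin

lift_definition inner_l2 :: "l2 \<Rightarrow> l2 \<Rightarrow> real" is
  "\<lambda>f g. LINT s|lebesgue_on {-1..0}. f s * g s"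
  unfolding l2_rel_def
  by (intro integral_cong_AE) (auto simp: sq_integrable_def elim: eventually_elim2)

definition norm_l2 :: "l2 \<Rightarrow> real" where
  "norm_l2 f = sqrt (inner f f)"

definition sgn_l2 :: "l2 \<Rightarrow> l2" where
  "sgn_l2 f = f /\<^sub>R norm f"

definition dist_l2 :: "l2 \<Rightarrow> l2 \<Rightarrow> real" where
  "dist_l2 f g = norm (f - g)"

definition uniformity_l2 :: "(l2 \<times> l2) filter" where
  "uniformity_l2 = (INF e\<in>{0<..}. principal {(x, y). dist x y < e})"

definition open_l2 :: "l2 set \<Rightarrow> bool" where
  "open_l2 U \<longleftrightarrow> (\<forall>x\<in>U. eventually (\<lambda>(x', y). x' = x \<longrightarrow> y \<in> U) uniformity)"

instance
proof
  fix a b c :: l2 and r :: real and U :: "l2 set"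
  show "dist a b = norm (a - b)" by (rule dist_l2_def)
  show "uniformity = (INF e\<in>{0<..}. principal {(x, y :: l2). dist x y < e})"
    by (rule uniformity_l2_def)
  show "open U \<longleftrightarrow> (\<forall>x\<in>U. eventually (\<lambda>(x', y). x' = x \<longrightarrow> y \<in> U) uniformity)"
    by (rule open_l2_def)
  show "sgn a = a /\<^sub>R norm a" by (rule sgn_l2_def)
  show "inner a b = inner b a"
    by transfer (simp add: mult.commute)
  show "inner (a + b) c = inner a c + inner b c"
    by transfer (simp add: l2_rel_refl_iff distrib_right sq_integrable_times)
  show "inner (r *\<^sub>R a) b = r * inner a b"
    by transfer (simp add: mult.assoc)
  show "0 \<le> inner a a"
    by transfer simp
  show "inner a a = 0 \<longleftrightarrow> a = 0"
  proof (transfer)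
    fix f assume "l2_rel f f"
    then have f: "sq_integrable f" by (simp add: l2_rel_refl_iff)
    have "(LINT s|lebesgue_on {-1..0}. f s * f s) = 0 \<longleftrightarrow>
        (AE s in lebesgue_on {-1..0}. f s * f s = 0)"
      by (rule integral_nonneg_eq_0_iff_AE) (auto intro: sq_integrable_times f)
    then show "(LINT s|lebesgue_on {-1..0}. f s * f s) = 0 \<longleftrightarrow> l2_rel f (\<lambda>s. 0)"
      by (simp add: l2_rel_def f sq_integrable_zero)
  qed
  show "norm a = sqrt (inner a a)" by (rule norm_l2_def)
qed

end

section \<open>Finite tuples, of possibly zero length\<close>

text \<open>
  The dimension is \<open>LENGTH('n)\<close> for an index type of class \<^class>\<open>len0\<close>. In contrast to the index
  types of \<open>real ^ 'n\<close>, this includes the dimension zero; every natural number is the length of a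
  numeral type, so a free type variable of this class ranges over all dimensions.
\<close>

typedef (overloaded) ('a::zero, 'n::len0) tuple = "{x :: nat \<Rightarrow> 'a. \<forall>i\<ge>LENGTH('n). x i = 0}"
  morphisms coord Abs_tuple
  by (rule exI[of _ "\<lambda>i. 0"]) simp

setup_lifting type_definition_tuple

lemma tuple_eqI: "(\<And>i. i < LENGTH('n) \<Longrightarrow> coord x i = coord y i) \<Longrightarrow> x = y"
  for x y :: "('a::zero, 'n::len0) tuple"
proof -
  assume eq: "coord x i = coord y i" if "i < LENGTH('n)" for i
  have "coord x i = coord y i" for i
    using eq[of i] coord[of x] coord[of y] by (cases "i < LENGTH('n)") auto
  then show "x = y"
    by (simp add: coord_inject[symmetric] fun_eq_iff)
qed

lift_definition mk_tuple :: "(nat \<Rightarrow> 'a) \<Rightarrow> ('a::zero, 'n::len0) tuple" is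
  "\<lambda>f i. if i < LENGTH('n) then f i else 0"
  by simp

lemma coord_mk_tuple:
  "coord (mk_tuple f :: ('a::zero, 'n::len0) tuple) i = (if i < LENGTH('n) then f i else 0)"
  by transfer simp

instantiation tuple :: (real_vector, len0) real_vector
begin

lift_definition zero_tuple :: "('a, 'b) tuple" is "\<lambda>i. 0" by simp
lift_definition plus_tuple :: "('a, 'b) tuple \<Rightarrow> ('a, 'b) tuple \<Rightarrow> ('a, 'b) tuple" is
  "\<lambda>x y i. x i + y i" by simp
lift_definition minus_tuple :: "('a, 'b) tuple \<Rightarrow> ('a, 'b) tuple \<Rightarrow> ('a, 'b) tuple" is
  "\<lambda>x y i. x i - y i" by simp
lift_definition uminus_tuple :: "('a, 'b) tuple \<Rightarrow> ('a, 'b) tuple" is "\<lambda>x i. - x i" by simp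
lift_definition scaleR_tuple :: "real \<Rightarrow> ('a, 'b) tuple \<Rightarrow> ('a, 'b) tuple" is
  "\<lambda>c x i. c *\<^sub>R x i" by simp

instance
  by standard
    (auto simp: zero_tuple.rep_eq plus_tuple.rep_eq minus_tuple.rep_eq uminus_tuple.rep_eq
      scaleR_tuple.rep_eq scaleR_add_left scaleR_add_right intro!: tuple_eqI)

end

instantiation tuple :: (real_inner, len0) real_inner
begin

definition inner_tuple :: "('a, 'b) tuple \<Rightarrow> ('a, 'b) tuple \<Rightarrow> real" where
  "inner_tuple x y = (\<Sum>i<LENGTH('b). inner (coord x i) (coord y i))"

definition norm_tuple :: "('a, 'b) tuple \<Rightarrow> real" where
  "norm_tuple x = sqrt (inner x x)"

definition sgn_tuple :: "('a, 'b) tuple \<Rightarrow> ('a, 'b) tuple" where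
  "sgn_tuple x = x /\<^sub>R norm x"

definition dist_tuple :: "('a, 'b) tuple \<Rightarrow> ('a, 'b) tuple \<Rightarrow> real" where
  "dist_tuple x y = norm (x - y)"

definition uniformity_tuple :: "(('a, 'b) tuple \<times> ('a, 'b) tuple) filter" where
  "uniformity_tuple = (INF e\<in>{0<..}. principal {(x, y). dist x y < e})"

definition open_tuple :: "('a, 'b) tuple set \<Rightarrow> bool" where
  "open_tuple U \<longleftrightarrow> (\<forall>x\<in>U. eventually (\<lambda>(x', y). x' = x \<longrightarrow> y \<in> U) uniformity)"

instance
proof
  fix a b c :: "('a, 'b) tuple" and r :: real and U :: "('a, 'b) tuple set"
  show "dist a b = norm (a - b)" by (rule dist_tuple_def)
  show "uniformity = (INF e\<in>{0<..}. principal {(x, y :: ('a, 'b) tuple). dist x y < e})"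
    by (rule uniformity_tuple_def)
  show "open U \<longleftrightarrow> (\<forall>x\<in>U. eventually (\<lambda>(x', y). x' = x \<longrightarrow> y \<in> U) uniformity)"
    by (rule open_tuple_def)
  show "sgn a = a /\<^sub>R norm a" by (rule sgn_tuple_def)
  show "inner a b = inner b a"
    by (simp add: inner_tuple_def inner_commute)
  show "inner (a + b) c = inner a c + inner b c"
    by (simp add: inner_tuple_def plus_tuple.rep_eq inner_add_left sum.distrib)
  show "inner (r *\<^sub>R a) b = r * inner a b"
    by (simp add: inner_tuple_def scaleR_tuple.rep_eq sum_distrib_left)
  show "0 \<le> inner a a"
    by (simp add: inner_tuple_def sum_nonneg)
  show "inner a a = 0 \<longleftrightarrow> a = 0"
    by (auto simp: inner_tuple_def sum_nonneg_eq_0_iff zero_tuple.rep_eq intro!: tuple_eqI)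
  show "norm a = sqrt (inner a a)" by (rule norm_tuple_def)
qed

end

section \<open>4-PI operators\<close>

text \<open>
  Norm and inner product of \<open>('m, 'n) rl2\<close> are those of the product type. The space
  \<open>\<real>\<^sup>k\<close> is \<open>('k, 0) rl2\<close>, where \<open>0\<close> is the numeral type of length zero.
\<close>

type_synonym ('m, 'n) rl2 = "(real, 'm) tuple \<times> (l2, 'n) tuple"

text \<open>
  A polynomial in \<open>(s, \<theta>)\<close> is an element of \<open>\<real>[s][\<theta>]\<close>: the outer polynomial variable is \<open>\<theta>\<close>.
\<close>

definition poly2 :: "real poly poly \<Rightarrow> real \<Rightarrow> real \<Rightarrow> real" where
  "poly2 p s \<theta> = poly (poly p [:\<theta>:]) s"

text \<open>
  The function \<^const>\<open>rep_l2\<close> picks a representative. Each integral below is the same for all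
  representatives, and the second equation is one between elements of L2, hence holds almost
  everywhere.
\<close>

definition has_pi_form :: "(('m::len0, 'n::len0) rl2 \<Rightarrow> ('p::len0, 'q::len0) rl2) \<Rightarrow>
    real mat \<Rightarrow> real poly mat \<Rightarrow> real poly mat \<Rightarrow> real poly mat \<Rightarrow>
    real poly poly mat \<Rightarrow> real poly poly mat \<Rightarrow> bool" where
  "has_pi_form \<P> P Q1 Q2 R0 R1 R2 \<longleftrightarrow> (\<forall>x f.
     (\<forall>i<LENGTH('p). coord (fst (\<P> (x, f))) i =
        (\<Sum>j<LENGTH('m). P $$ (i, j) * coord x j) +
        (LINT \<theta>:{-1..0}|lebesgue. \<Sum>j<LENGTH('n). poly (Q1 $$ (i, j)) \<theta> * rep_l2 (coord f j) \<theta>)) \<and>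
     (\<forall>i<LENGTH('q). AE s in lebesgue_on {-1..0}. rep_l2 (coord (snd (\<P> (x, f))) i) s =
        (\<Sum>j<LENGTH('m). poly (Q2 $$ (i, j)) s * coord x j) +
        (\<Sum>j<LENGTH('n). poly (R0 $$ (i, j)) s * rep_l2 (coord f j) s) +
        (LINT \<theta>:{-1..s}|lebesgue. \<Sum>j<LENGTH('n). poly2 (R1 $$ (i, j)) s \<theta> * rep_l2 (coord f j) \<theta>) +
        (LINT \<theta>:{s..0}|lebesgue. \<Sum>j<LENGTH('n). poly2 (R2 $$ (i, j)) s \<theta> * rep_l2 (coord f j) \<theta>)))"

definition pi_operator :: "(('m::len0, 'n::len0) rl2 \<Rightarrow> ('p::len0, 'q::len0) rl2) \<Rightarrow> bool" where
  "pi_operator \<P> \<longleftrightarrow> bounded_linear \<P> \<and>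
     (\<exists>P\<in>carrier_mat LENGTH('p) LENGTH('m). \<exists>Q1\<in>carrier_mat LENGTH('p) LENGTH('n).
      \<exists>Q2\<in>carrier_mat LENGTH('q) LENGTH('m). \<exists>R0\<in>carrier_mat LENGTH('q) LENGTH('n).
      \<exists>R1\<in>carrier_mat LENGTH('q) LENGTH('n). \<exists>R2\<in>carrier_mat LENGTH('q) LENGTH('n).
        has_pi_form \<P> P Q1 Q2 R0 R1 R2)"

definition mat_op :: "real mat \<Rightarrow> ('m::len0, 0) rl2 \<Rightarrow> ('p::len0, 0) rl2" where
  "mat_op A u = (mk_tuple (\<lambda>i. \<Sum>j<LENGTH('m). A $$ (i, j) * coord (fst u) j), 0)"

text \<open>To be used for self-adjoint \<open>\<G>\<close> only.\<close>

definition op_nonneg :: "('a::real_inner \<Rightarrow> 'a) \<Rightarrow> bool" where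
  "op_nonneg \<G> \<longleftrightarrow> (\<forall>x. 0 \<le> inner x (\<G> x))"

definition op_nonpos :: "('a::real_inner \<Rightarrow> 'a) \<Rightarrow> bool" where
  "op_nonpos \<G> \<longleftrightarrow> op_nonneg (\<lambda>x. - \<G> x)"

section \<open>Partial integral equations\<close>

definition pie_solution :: "('a::real_normed_vector \<Rightarrow> 'a) \<Rightarrow> ('a \<Rightarrow> 'a) \<Rightarrow> (real \<Rightarrow> 'a) \<Rightarrow> bool" where
  "pie_solution \<T> \<G> x \<longleftrightarrow>
     (\<forall>t\<ge>0. ((\<lambda>\<tau>. \<T> (x \<tau>)) has_vector_derivative \<G> (x t)) (at t within {0..}))"

definition exp_stable :: "('a::real_normed_vector \<Rightarrow> 'a) \<Rightarrow> ('a \<Rightarrow> 'a) \<Rightarrow> real \<Rightarrow> bool" where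
  "exp_stable \<T> \<G> \<alpha> \<longleftrightarrow> \<alpha> > 0 \<and> (\<exists>M. \<forall>x. pie_solution \<T> \<G> x \<longrightarrow>
     (\<forall>t\<ge>0. norm (\<T> (x t)) \<le> M * norm (\<T> (x 0)) * exp (- \<alpha> * t)))"

definition Phi_op ::
  "(('m::len0, 'n::len0) rl2 \<Rightarrow> ('m, 'n) rl2) \<Rightarrow> (('m, 'n) rl2 \<Rightarrow> ('m, 'n) rl2) \<Rightarrow>
   (('u::len0, 0) rl2 \<Rightarrow> ('m, 'n) rl2) \<Rightarrow> (('m, 'n) rl2 \<Rightarrow> ('y::len0, 0) rl2) \<Rightarrow>
   (('m, 'n) rl2 \<Rightarrow> ('u, 0) rl2) \<Rightarrow> (('m, 'n) rl2 \<Rightarrow> ('m, 'n) rl2) \<Rightarrow>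
   real mat \<Rightarrow> real mat \<Rightarrow> real \<Rightarrow> real \<Rightarrow>
   ('u, 0) rl2 \<times> ('m, 'n) rl2 \<Rightarrow> ('u, 0) rl2 \<times> ('m, 'n) rl2" where
  "Phi_op \<T> \<A> \<B> \<C> \<K> \<P> F Z \<alpha> \<epsilon> = (\<lambda>(u, z).
     (- mat_op F u + (\<epsilon> / 2) *\<^sub>R u
        + (adjoint \<B> (\<P> (\<T> z)) + mat_op Z (\<C> z) - mat_op F (\<K> z)),
      adjoint \<T> (\<P> (\<A> z + \<B> (\<K> z) + \<alpha> *\<^sub>R \<T> z))))"

end

theory Submission
  imports Defs "Jordan_Normal_Form.Determinant"
begin

text \<open>
  The function \<open>V(t) = \<langle>\<T> x(t), \<P> \<T> x(t)\<rangle>\<close> is a Lyapunov function. It is comparable to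
  \<open>\<parallel>\<T> x(t)\<parallel>\<^sup>2\<close>, from below because \<open>\<P>\<close> dominates \<open>\<delta> I\<close> and from above because \<open>\<P>\<close> is bounded, so
  it suffices that \<open>V' \<le> - 2 \<alpha> V\<close> along solutions (lemma \<open>exp_stable_if_lyapunov\<close>). As \<open>\<P>\<close> is
  self-adjoint, this follows from the inequality
  \<open>\<langle>\<T> z, \<P> (\<A> + \<B> L \<C> + \<alpha> \<T>) z\<rangle> \<le> 0\<close> for every state \<open>z\<close>.

  The operator inequality for \<open>\<Phi>\<close> says that the quadratic form of \<open>\<Phi>\<close> is nonpositive on every pair
  \<open>(u, z)\<close>, and two choices of \<open>u\<close> are enough. For \<open>z = 0\<close> it gives
  \<open>\<langle>u, F u\<rangle> \<ge> \<epsilon>/2 \<parallel>u\<parallel>\<^sup>2\<close>; hence \<open>F\<close> is invertible, \<open>L\<close> is meaningful and \<open>Z = F L\<close>. For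
  \<open>u = L \<C> z - \<K> z\<close>, the difference between the output feedback \<open>L \<C>\<close> and the state feedback \<open>\<K>\<close>, the
  first row contains \<open>- F u + Z \<C> z - F \<K> z = 0\<close>. What remains is
  \<open>\<epsilon>/2 \<parallel>u\<parallel>\<^sup>2\<close> plus \<open>\<langle>\<B> u, \<P> \<T> z\<rangle> + \<langle>\<T> z, \<P> (\<A> + \<B> \<K> + \<alpha> \<T>) z\<rangle>\<close>, and in the last two terms \<open>\<B> u\<close>
  turns \<open>\<B> \<K> z\<close> into \<open>\<B> L \<C> z\<close>.

  The constant \<^const>\<open>adjoint\<close> is a Hilbert choice, so each use of \<open>\<langle>x, f\<^sup>* y\<rangle> = \<langle>f x, y\<rangle>\<close> needs
  the existence of an adjoint. For bounded operators on a Hilbert space it comes from the Riesz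
  representation theorem (lemma \<open>inner_adjoint\<close>), which in turn rests on the completeness of L2,
  the Riesz-Fischer theorem.
\<close>

section \<open>Completeness of the state space\<close>

lemma l2_rel_rep_l2: "l2_rel (rep_l2 a) (rep_l2 a)"
  by (rule Quotient_rep_reflp[OF Quotient_l2])

lemma sq_integrable_rep_l2: "sq_integrable (rep_l2 a)"
  using l2_rel_rep_l2 by (simp add: l2_rel_refl_iff)

lemma abs_l2_rep_l2: "abs_l2 (rep_l2 a) = a"
  by (rule Quotient_abs_rep[OF Quotient_l2])

lemma sq_integrable_diff:
  assumes "sq_integrable f" "sq_integrable g"
  shows "sq_integrable (\<lambda>s. f s - g s)"
  using sq_integrable_add[OF assms(1) sq_integrable_scale[OF assms(2), of "-1"]] by simp

lemma dist_abs_l2: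
  assumes "sq_integrable f" "sq_integrable g"
  shows "(dist (abs_l2 f) (abs_l2 g))\<^sup>2 = (LINT s|lebesgue_on {-1..0}. (f s - g s)\<^sup>2)"
proof -
  have "abs_l2 f - abs_l2 g = abs_l2 (\<lambda>s. f s - g s)"
    using assms sq_integrable_scale[OF assms(2), of "-1"]
    by (simp add: minus_l2_def uminus_l2.abs_eq plus_l2.abs_eq l2_rel_refl_iff)
  then show ?thesis
    using sq_integrable_diff[OF assms]
    unfolding dist_norm power2_norm_eq_inner
    by (simp add: inner_l2.abs_eq l2_rel_refl_iff power2_eq_square)
qed

text \<open>
  On a space of finite measure the L1 norm is controlled by the L2 norm, so the increments have
  summable L1 norms. The sum of their absolute values is then integrable, hence finite almost
  everywhere, and the sequence is pointwise a convergent telescoping series.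
\<close>

lemma AE_convergent_of_fast_Cauchy:
  fixes f :: "nat \<Rightarrow> 'a \<Rightarrow> real"
  assumes fin: "finite_measure M"
    and meas: "\<And>n. f n \<in> borel_measurable M"
    and int: "\<And>n. integrable M (\<lambda>s. (f n s - f (Suc n) s)\<^sup>2)"
    and fast: "\<And>n. (\<integral>s. (f n s - f (Suc n) s)\<^sup>2 \<partial>M) \<le> (1/4) ^ n"
  shows "AE s in M. convergent (\<lambda>n. f n s)"
proof -
  interpret finite_measure M by fact
  define d where "d n s = f n s - f (Suc n) s" for n s
  define c where "c = (1 + measure M (space M)) / 2"
  have d_meas [measurable]: "d n \<in> borel_measurable M" for n
    unfolding d_def using meas[of n] meas[of "Suc n"] by measurable
  have L1: "(\<integral>\<^sup>+ s. ennreal \<bar>d n s\<bar> \<partial>M) \<le> ennreal (c * (1/2) ^ n)" for n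
  proof -
    let ?b = "\<lambda>s. (2 ^ n * (d n s)\<^sup>2 + (1/2) ^ n) / 2"
    have bint: "integrable M ?b"
      using int[of n] by (simp add: d_def)
    \<comment> \<open>Young's inequality with weight \<open>2 ^ n\<close>: half of the decay \<open>4 ^ (- n)\<close> is given up so that both
      terms have integrals of order \<open>2 ^ (- n)\<close>.\<close>
    have pw: "\<bar>d n s\<bar> \<le> ?b s" for s
    proof -
      have "0 \<le> (2 ^ n * \<bar>d n s\<bar> - 1)\<^sup>2 / 2 ^ n"
        by simp
      also have "\<dots> = 2 ^ n * (d n s)\<^sup>2 + (1/2) ^ n - 2 * \<bar>d n s\<bar>"
        by (simp add: power2_diff power_mult_distrib power_one_over field_simps power2_eq_square)
      finally show ?thesis by simp
    qed
    have "(\<integral>\<^sup>+ s. ennreal \<bar>d n s\<bar> \<partial>M) \<le> (\<integral>\<^sup>+ s. ennreal (?b s) \<partial>M)"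
      by (intro nn_integral_mono ennreal_leI pw)
    also have "\<dots> = ennreal (\<integral>s. ?b s \<partial>M)"
      by (intro nn_integral_eq_integral bint) (simp add: field_simps)
    also have "(\<integral>s. ?b s \<partial>M) = (2 ^ n * (\<integral>s. (d n s)\<^sup>2 \<partial>M) + (1/2) ^ n * measure M (space M)) / 2"
      using int[of n] by (simp add: d_def)
    also have "\<dots> \<le> (2 ^ n * (1/4) ^ n + (1/2) ^ n * measure M (space M)) / 2"
      using fast[of n] by (simp add: d_def)
    also have "(2::real) ^ n * (1/4) ^ n = (1/2) ^ n"
      by (simp flip: power_mult_distrib)
    finally show ?thesis
      by (simp add: c_def algebra_simps add_divide_distrib ennreal_leI)
  qed
  have "(\<integral>\<^sup>+ s. (\<Sum>n. ennreal \<bar>d n s\<bar>) \<partial>M) = (\<Sum>n. \<integral>\<^sup>+ s. ennreal \<bar>d n s\<bar> \<partial>M)"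
    by (rule nn_integral_suminf) measurable
  also have "\<dots> \<le> (\<Sum>n. ennreal (c * (1/2) ^ n))"
    by (intro suminf_le L1) auto
  also have "\<dots> = ennreal (\<Sum>n. c * (1/2) ^ n)"
    by (intro suminf_ennreal2 summable_mult summable_geometric) (auto simp: c_def)
  also have "\<dots> < \<infinity>" by simp
  finally have "(\<integral>\<^sup>+ s. (\<Sum>n. ennreal \<bar>d n s\<bar>) \<partial>M) \<noteq> \<infinity>" by simp
  then have "AE s in M. (\<Sum>n. ennreal \<bar>d n s\<bar>) \<noteq> \<infinity>"
    by (intro nn_integral_PInf_AE) auto
  then show ?thesis
  proof (rule AE_mp, intro AE_I2 impI)
    fix s assume "(\<Sum>n. ennreal \<bar>d n s\<bar>) \<noteq> \<infinity>"
    then have "summable (\<lambda>n. \<bar>d n s\<bar>)"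
      by (intro summable_suminf_not_top) auto
    then have "summable (\<lambda>n. d n s)"
      by (rule summable_rabs_cancel)
    then have "convergent (\<lambda>n. \<Sum>k<n. d k s)"
      by (simp add: summable_iff_convergent)
    then have "convergent (\<lambda>n. f 0 s - (\<Sum>k<n. d k s))"
      by (intro convergent_diff convergent_const)
    also have "(\<lambda>n. f 0 s - (\<Sum>k<n. d k s)) = (\<lambda>n. f n s)"
    proof
      show "f 0 s - (\<Sum>k<n. d k s) = f n s" for n
        by (induction n) (auto simp: d_def)
    qed
    finally show "convergent (\<lambda>n. f n s)" .
  qed
qed

text \<open>
  Fatou's lemma: L2 balls are closed under pointwise limits. It makes the pointwise limit of a Cauchy
  sequence its limit in the L2 norm, and square-integrable.
\<close>

lemma integral_square_limit_le:
  fixes f :: "nat \<Rightarrow> 'a \<Rightarrow> real"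
  assumes [measurable]: "\<And>n. f n \<in> borel_measurable M" "g \<in> borel_measurable M" "h \<in> borel_measurable M"
    and lim: "AE s in M. (\<lambda>n. f n s) \<longlonglongrightarrow> g s"
    and int: "\<And>n. integrable M (\<lambda>s. (f n s - h s)\<^sup>2)"
    and le: "\<And>n. n \<ge> N \<Longrightarrow> (\<integral>s. (f n s - h s)\<^sup>2 \<partial>M) \<le> c"
    and c: "c \<ge> 0"
  shows "integrable M (\<lambda>s. (g s - h s)\<^sup>2) \<and> (\<integral>s. (g s - h s)\<^sup>2 \<partial>M) \<le> c"
proof -
  have "(\<integral>\<^sup>+ s. ennreal ((g s - h s)\<^sup>2) \<partial>M) = (\<integral>\<^sup>+ s. liminf (\<lambda>n. ennreal ((f n s - h s)\<^sup>2)) \<partial>M)"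
  proof (rule nn_integral_cong_AE, use lim in eventually_elim)
    fix s assume "(\<lambda>n. f n s) \<longlonglongrightarrow> g s"
    then have "(\<lambda>n. ennreal ((f n s - h s)\<^sup>2)) \<longlonglongrightarrow> ennreal ((g s - h s)\<^sup>2)"
      by (intro tendsto_intros)
    then show "ennreal ((g s - h s)\<^sup>2) = liminf (\<lambda>n. ennreal ((f n s - h s)\<^sup>2))"
      using lim_imp_Liminf[OF sequentially_bot] by metis
  qed
  also have "\<dots> \<le> liminf (\<lambda>n. \<integral>\<^sup>+ s. ennreal ((f n s - h s)\<^sup>2) \<partial>M)"
    by (rule nn_integral_liminf) measurable
  also have "\<dots> \<le> liminf (\<lambda>n. ennreal c)"
  proof (rule Liminf_mono)
    show "\<forall>\<^sub>F n in sequentially. (\<integral>\<^sup>+ s. ennreal ((f n s - h s)\<^sup>2) \<partial>M) \<le> ennreal c"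
      using eventually_ge_at_top[of N]
      by eventually_elim (simp add: nn_integral_eq_integral int le ennreal_leI)
  qed
  also have "\<dots> = ennreal c"
    by (simp add: Liminf_const)
  finally have le: "(\<integral>\<^sup>+ s. ennreal ((g s - h s)\<^sup>2) \<partial>M) \<le> ennreal c" .
  then have int: "integrable M (\<lambda>s. (g s - h s)\<^sup>2)"
    by (intro integrableI_nonneg) (auto simp: le_less_trans)
  then show ?thesis
    using le c by (simp add: nn_integral_eq_integral)
qed

text \<open>
  Riesz-Fischer: pass to a subsequence with geometrically small steps, take its pointwise limit
  almost everywhere, and estimate the distance to that limit by Fatou's lemma.
\<close>

instance l2 :: complete_space
proof
  fix X :: "nat \<Rightarrow> l2"
  assume X: "Cauchy X"
  let ?M = "lebesgue_on {-1..0::real}"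
  have fin: "finite_measure ?M"
    by (intro finite_measureI) (simp add: emeasure_restrict_space)
  obtain r :: "nat \<Rightarrow> nat" where r: "strict_mono r"
    and fast: "\<And>n. dist (X (r n)) (X (r (Suc n))) < (1/2) ^ n"
  proof -
    have "\<exists>N. \<forall>m\<ge>N. \<forall>k\<ge>N. dist (X m) (X k) < (1/2) ^ n" for n :: nat
      using X unfolding Cauchy_def by (metis zero_less_divide_1_iff zero_less_numeral zero_less_power)
    then obtain N where N: "\<And>n m k. m \<ge> N n \<Longrightarrow> k \<ge> N n \<Longrightarrow> dist (X m) (X k) < (1/2) ^ n"
      by metis
    \<comment> \<open>The sum over \<open>k \<le> n\<close> makes \<open>r n \<ge> N n\<close>; the summand \<open>n\<close> makes \<open>r\<close> strictly monotone.\<close>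
    define r where "r n = n + (\<Sum>k\<le>n. N k)" for n
    have ge: "r n \<ge> N n" for n
      unfolding r_def using member_le_sum[of n "{..n}" N] by simp
    have mono: "r n < r (Suc n)" for n
      by (simp add: r_def)
    show thesis
    proof (rule that)
      show "strict_mono r" using mono by (simp add: strict_mono_Suc_iff)
      show "dist (X (r n)) (X (r (Suc n))) < (1/2) ^ n" for n
        using N[of n "r n" "r (Suc n)"] ge[of n] mono[of n] by simp
    qed
  qed
  define f where "f n = rep_l2 (X (r n))" for n
  \<comment> \<open>Where the sequence diverges, \<^const>\<open>lim\<close> has an arbitrary value. It occurs on a null set only,
    and \<open>g\<close> is measurable nevertheless.\<close>
  define g where "g s = lim (\<lambda>n. f n s)" for s
  have sq: "sq_integrable (f n)" for n
    by (simp add: f_def sq_integrable_rep_l2)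
  have absf: "abs_l2 (f n) = X (r n)" for n
    by (simp add: f_def abs_l2_rep_l2)
  have fm [measurable]: "f n \<in> borel_measurable ?M" for n
    using sq by (simp add: sq_integrable_def)
  have gm [measurable]: "g \<in> borel_measurable ?M"
    unfolding g_def by measurable
  have int: "integrable ?M (\<lambda>s. (f m s - f n s)\<^sup>2)" for m n
    using sq_integrable_diff[OF sq sq] by (simp add: sq_integrable_def)
  have int_eq: "(LINT s|?M. (f m s - f n s)\<^sup>2) = (dist (X (r m)) (X (r n)))\<^sup>2" for m n
    using dist_abs_l2[OF sq sq] by (simp add: absf)
  have "AE s in ?M. convergent (\<lambda>n. f n s)"
  proof (rule AE_convergent_of_fast_Cauchy[OF fin fm int])
    fix n
    have "(dist (X (r n)) (X (r (Suc n))))\<^sup>2 \<le> ((1/2) ^ n)\<^sup>2"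
      using fast[of n] by (intro power_mono) auto
    also have "\<dots> = (1/4 :: real) ^ n"
      by (simp add: power2_eq_square flip: power_mult_distrib)
    finally show "(LINT s|?M. (f n s - f (Suc n) s)\<^sup>2) \<le> (1/4) ^ n"
      by (simp add: int_eq)
  qed
  then have lim: "AE s in ?M. (\<lambda>n. f n s) \<longlonglongrightarrow> g s"
    by eventually_elim (simp add: g_def convergent_LIMSEQ_iff)
  have Y: "Cauchy (X \<circ> r)"
    using X r by (rule Cauchy_subseq_Cauchy)
  have close: "integrable ?M (\<lambda>s. (g s - f n s)\<^sup>2) \<and> (LINT s|?M. (g s - f n s)\<^sup>2) \<le> e\<^sup>2"
    if "\<And>m. m \<ge> N \<Longrightarrow> dist (X (r m)) (X (r n)) \<le> e" "e > 0" for e n N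
    by (rule integral_square_limit_le[OF fm gm fm lim int, of N])
      (use that in \<open>auto simp: int_eq intro: power_mono\<close>)
  have close': "\<exists>N. \<forall>n\<ge>N. integrable ?M (\<lambda>s. (g s - f n s)\<^sup>2) \<and> (LINT s|?M. (g s - f n s)\<^sup>2) \<le> e\<^sup>2"
    if e: "e > 0" for e
  proof -
    obtain N where "\<forall>m\<ge>N. \<forall>n\<ge>N. dist (X (r m)) (X (r n)) < e"
      using Y e unfolding Cauchy_def by auto
    then show ?thesis
      using close[of N _ e] e by (blast intro: less_imp_le)
  qed
  have g: "sq_integrable g"
  proof -
    obtain n where "integrable ?M (\<lambda>s. (g s - f n s)\<^sup>2)"
      using close'[of 1] by auto
    then have "sq_integrable (\<lambda>s. g s - f n s)"
      by (simp add: sq_integrable_def)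
    from sq_integrable_add[OF this sq[of n]] show ?thesis by simp
  qed
  have "(X \<circ> r) \<longlonglongrightarrow> abs_l2 g"
  proof (rule metric_LIMSEQ_I)
    fix e :: real assume e: "e > 0"
    obtain N where N: "\<And>n. n \<ge> N \<Longrightarrow> (LINT s|?M. (g s - f n s)\<^sup>2) \<le> (e/2)\<^sup>2"
      using close'[of "e/2"] e by auto
    show "\<exists>N. \<forall>n\<ge>N. dist ((X \<circ> r) n) (abs_l2 g) < e"
    proof (intro exI allI impI)
      fix n assume "n \<ge> N"
      then have "(dist (abs_l2 g) (X (r n)))\<^sup>2 \<le> (e/2)\<^sup>2"
        using N[of n] dist_abs_l2[OF g sq[of n]] by (simp add: absf)
      then have "dist (abs_l2 g) (X (r n)) \<le> e/2"
        by (rule power2_le_imp_le) (use e in simp)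
      then show "dist ((X \<circ> r) n) (abs_l2 g) < e"
        using e by (simp add: dist_commute)
    qed
  qed
  from Cauchy_converges_subseq[OF X r this] show "convergent X"
    by (rule convergentI)
qed

lemma bounded_linear_coord: "bounded_linear (\<lambda>x :: ('a::real_inner, 'n::len0) tuple. coord x i)"
proof (rule bounded_linear_intro[of _ 1])
  fix x y :: "('a, 'n) tuple" and c :: real
  show "coord (x + y) i = coord x i + coord y i" "coord (c *\<^sub>R x) i = c *\<^sub>R coord x i"
    by (simp_all add: plus_tuple.rep_eq scaleR_tuple.rep_eq)
  show "norm (coord x i) \<le> norm x * 1"
  proof (cases "i < LENGTH('n)")
    case True
    have "(norm (coord x i))\<^sup>2 \<le> (\<Sum>i<LENGTH('n). (norm (coord x i))\<^sup>2)"
      using True by (intro member_le_sum) auto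
    also have "\<dots> = (norm x)\<^sup>2"
      by (simp add: power2_norm_eq_inner inner_tuple_def)
    finally have "norm (coord x i) \<le> norm x"
      by (rule power2_le_imp_le) simp
    then show ?thesis by simp
  qed (use coord[of x] in auto)
qed

definition unit_tuple :: "nat \<Rightarrow> 'a \<Rightarrow> ('a::real_vector, 'n::len0) tuple" where
  "unit_tuple i a = mk_tuple (\<lambda>j. if j = i then a else 0)"

lemma coord_sum: "coord (\<Sum>i\<in>I. g i) j = (\<Sum>i\<in>I. coord (g i) j)"
  for g :: "'i \<Rightarrow> ('a::real_vector, 'n::len0) tuple"
  by (induction I rule: infinite_finite_induct) (simp_all add: zero_tuple.rep_eq plus_tuple.rep_eq)

lemma mk_tuple_eq_sum:
  "(mk_tuple g :: ('a::real_vector, 'n::len0) tuple) = (\<Sum>i<LENGTH('n). unit_tuple i (g i))"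
  by (rule tuple_eqI) (simp add: coord_sum unit_tuple_def coord_mk_tuple)

lemma bounded_linear_unit_tuple: "bounded_linear (unit_tuple i :: _ \<Rightarrow> ('a::real_inner, 'n::len0) tuple)"
proof (rule bounded_linear_intro[of _ 1])
  fix a b :: 'a and c :: real
  show "(unit_tuple i (a + b) :: ('a, 'n) tuple) = unit_tuple i a + unit_tuple i b"
    "(unit_tuple i (c *\<^sub>R a) :: ('a, 'n) tuple) = c *\<^sub>R unit_tuple i a"
    by (auto intro!: tuple_eqI
      simp: unit_tuple_def coord_mk_tuple plus_tuple.rep_eq scaleR_tuple.rep_eq)
  have "inner (unit_tuple i a :: ('a, 'n) tuple) (unit_tuple i a) = (\<Sum>j<LENGTH('n). if j = i then inner a a else 0)"
    unfolding inner_tuple_def by (intro sum.cong) (auto simp: unit_tuple_def coord_mk_tuple)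
  then have "inner (unit_tuple i a :: ('a, 'n) tuple) (unit_tuple i a) \<le> inner a a"
    by simp
  then show "norm (unit_tuple i a :: ('a, 'n) tuple) \<le> norm a * 1"
    by (simp add: norm_eq_sqrt_inner)
qed

lemma bounded_linear_mk_tuple:
  assumes "\<And>i. i < LENGTH('n) \<Longrightarrow> bounded_linear (g i)"
  shows "bounded_linear (\<lambda>x. mk_tuple (\<lambda>i. g i x) :: ('a::real_inner, 'n::len0) tuple)"
  unfolding mk_tuple_eq_sum
  by (intro bounded_linear_sum bounded_linear_compose[OF bounded_linear_unit_tuple] assms) simp

instance tuple :: ("{real_inner, complete_space}", len0) complete_space
proof
  fix X :: "nat \<Rightarrow> ('a, 'b) tuple"
  assume X: "Cauchy X"
  have "\<exists>l. (\<lambda>n. coord (X n) i) \<longlonglongrightarrow> l" for i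
    using bounded_linear.Cauchy[OF bounded_linear_coord X]
    by (simp add: Cauchy_convergent_iff convergent_def)
  then obtain l where l: "\<And>i. (\<lambda>n. coord (X n) i) \<longlonglongrightarrow> l i"
    by metis
  have "(\<lambda>n. \<Sum>i<LENGTH('b). unit_tuple i (coord (X n) i) :: ('a, 'b) tuple)
      \<longlonglongrightarrow> (\<Sum>i<LENGTH('b). unit_tuple i (l i))"
    by (intro tendsto_sum bounded_linear.tendsto[OF bounded_linear_unit_tuple] l)
  moreover have "(\<Sum>i<LENGTH('b). unit_tuple i (coord x i)) = x" for x :: "('a, 'b) tuple"
    by (rule tuple_eqI) (simp add: coord_mk_tuple flip: mk_tuple_eq_sum)
  ultimately show "convergent X"
    by (auto simp: convergent_def)
qed

section \<open>Adjoints of bounded operators on a Hilbert space\<close>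

lemma parallelogram_midpoint:
  fixes x y :: "'a::real_inner"
  shows "(norm (x - y))\<^sup>2 = 2 * (norm x)\<^sup>2 + 2 * (norm y)\<^sup>2 - 4 * (norm ((1/2) *\<^sub>R (x + y)))\<^sup>2"
  by (simp add: power2_norm_eq_inner inner_simps inner_commute algebra_simps)

text \<open>
  The representing vector is the minimiser of \<open>\<parallel>x\<parallel>\<^sup>2 - 2 f x\<close>, which equals \<open>\<parallel>x - v\<parallel>\<^sup>2 - \<parallel>v\<parallel>\<^sup>2\<close> if
  \<open>f x = \<langle>x, v\<rangle>\<close>. By the parallelogram identity every minimising sequence is Cauchy, so completeness
  provides a minimiser, and the first-order condition there is the representation of \<open>f\<close>.
\<close>

lemma riesz_representation:
  fixes f :: "'a::{real_inner, complete_space} \<Rightarrow> real"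
  assumes "bounded_linear f"
  shows "\<exists>v. \<forall>x. f x = inner x v"
proof -
  interpret f: bounded_linear f by fact
  define g where "g x = (norm x)\<^sup>2 - 2 * f x" for x
  obtain K where K: "\<And>x. norm (f x) \<le> norm x * K"
    using f.bounded by auto
  have "- K\<^sup>2 \<le> g x" for x
  proof -
    have "0 \<le> (norm x - K)\<^sup>2" by simp
    also have "\<dots> \<le> g x + K\<^sup>2"
      using K[of x] by (simp add: g_def power2_diff abs_le_iff)
    finally show ?thesis by simp
  qed
  then have bdd: "bdd_below (range g)"
    by (intro bdd_belowI[of _ "- K\<^sup>2"]) auto
  define m where "m = Inf (range g)"
  have m: "m \<le> g x" for x
    unfolding m_def using bdd by (intro cInf_lower) auto
  have "\<exists>x. g x < m + inverse (real (Suc n))" for n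
  proof -
    have "Inf (range g) < m + inverse (real (Suc n))"
      by (simp add: m_def)
    then show ?thesis
      using cInf_lessD[of "range g"] by blast
  qed
  then obtain X where X: "\<And>n. g (X n) < m + inverse (real (Suc n))"
    by metis
  have dist_X: "(dist x y)\<^sup>2 \<le> 2 * g x + 2 * g y - 4 * m" for x y
  proof -
    define w where "w = (1/2) *\<^sub>R (x + y)"
    have "2 * f w = f x + f y"
      by (simp add: w_def f.scaleR f.add)
    then show ?thesis
      using m[of w] parallelogram_midpoint[of x y]
      unfolding w_def[symmetric] g_def dist_norm by (simp add: algebra_simps)
  qed
  have "Cauchy X"
  proof (rule metric_CauchyI)
    fix e :: real assume e: "e > 0"
    have "0 < e\<^sup>2 / 4" using e by simp
    then obtain N where N: "inverse (real (Suc N)) < e\<^sup>2 / 4"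
      using reals_Archimedean by blast
    show "\<exists>N. \<forall>m\<ge>N. \<forall>n\<ge>N. dist (X m) (X n) < e"
    proof (intro exI[of _ N] allI impI)
      fix i j assume "N \<le> i" "N \<le> j"
      then have "inverse (real (Suc i)) \<le> inverse (real (Suc N))"
        "inverse (real (Suc j)) \<le> inverse (real (Suc N))"
        by (intro le_imp_inverse_le; simp)+
      then have "(dist (X i) (X j))\<^sup>2 < e\<^sup>2"
        using N dist_X[of "X i" "X j"] X[of i] X[of j] by linarith
      then show "dist (X i) (X j) < e"
        by (rule power2_less_imp_less) (use e in simp)
    qed
  qed
  then obtain v where v: "X \<longlonglongrightarrow> v"
    by (auto simp: Cauchy_convergent_iff convergent_def)
  have "(\<lambda>n. g (X n)) \<longlonglongrightarrow> g v"
    unfolding g_def by (intro tendsto_intros f.tendsto v)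
  moreover have "(\<lambda>n. m + inverse (real (Suc n))) \<longlonglongrightarrow> m"
    by (rule LIMSEQ_inverse_real_of_nat_add)
  ultimately have "g v \<le> m"
    by (rule LIMSEQ_le) (use X less_imp_le in blast)
  then have min: "g v \<le> g x" for x
    using m[of x] by linarith
  have "f h = inner h v" for h
  proof -
    define a where "a = inner h v - f h"
    define q where "q = (norm h)\<^sup>2 + 1"
    have q: "q > 0" by (simp add: q_def add_nonneg_pos)
    \<comment> \<open>A step against the slope \<open>2 a\<close> in the direction \<open>h\<close>. The denominator is nonzero even for
      \<open>h = 0\<close>.\<close>
    define t where "t = - a / q"
    have "0 \<le> g (v + t *\<^sub>R h) - g v"
      using min by simp
    also have "\<dots> = 2 * t * a + t\<^sup>2 * (q - 1)"
    proof -
      have "(norm (v + t *\<^sub>R h))\<^sup>2 = (norm v)\<^sup>2 + 2 * t * inner h v + t\<^sup>2 * (norm h)\<^sup>2"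
        unfolding power2_norm_eq_inner
        by (simp add: inner_simps inner_commute power2_eq_square algebra_simps)
      then show ?thesis
        by (simp add: g_def a_def q_def f.add f.scaleR algebra_simps)
    qed
    also have "\<dots> = - (a\<^sup>2 * (q + 1)) / q\<^sup>2"
      using q by (simp add: t_def field_simps power2_eq_square)
    finally have "a\<^sup>2 * (q + 1) \<le> 0"
      using q by (simp add: divide_le_0_iff)
    then have "a = 0"
      using q by (simp add: mult_le_0_iff)
    then show ?thesis by (simp add: a_def)
  qed
  then show ?thesis by blast
qed

text \<open>
  The infinite-dimensional form of \<open>adjoint_works\<close>: the vector \<open>adjoint f y\<close> represents the functional
  \<open>x \<mapsto> \<langle>f x, y\<rangle>\<close>. This functional lives on the domain of \<open>f\<close>, which is why the domain has to be
  complete.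
\<close>

lemma inner_adjoint:
  fixes f :: "'a::{real_inner, complete_space} \<Rightarrow> 'b::real_inner"
  assumes "bounded_linear f"
  shows "inner x (adjoint f y) = inner (f x) y"
proof -
  have "\<exists>w. \<forall>x. inner (f x) y = inner x w" for y
    by (rule riesz_representation)
      (rule bounded_linear_compose[OF bounded_linear_inner_left assms])
  then have "\<exists>f'. \<forall>x y. inner (f x) y = inner x (f' y)"
    by metis
  then have "\<forall>x y. inner (f x) y = inner x (adjoint f y)"
    unfolding adjoint_def by (rule someI_ex)
  then show ?thesis by simp
qed

lemma bounded_linear_adjoint:
  fixes f :: "'a::{real_inner, complete_space} \<Rightarrow> 'b::real_inner"
  assumes "bounded_linear f"
  shows "bounded_linear (adjoint f)"
proof -
  obtain K where K: "K \<ge> 0" "\<And>x. norm (f x) \<le> norm x * K"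
    using bounded_linear.nonneg_bounded[OF assms] by blast
  show ?thesis
  proof (rule bounded_linear_intro[of _ K])
    fix x y :: 'b and c :: real
    show "adjoint f (x + y) = adjoint f x + adjoint f y"
      by (simp add: vector_eq_ldot[symmetric] inner_add_right inner_adjoint[OF assms])
    show "adjoint f (c *\<^sub>R x) = c *\<^sub>R adjoint f x"
      by (simp add: vector_eq_ldot[symmetric] inner_adjoint[OF assms])
    let ?a = "adjoint f x"
    have "norm ?a * norm ?a = inner (f ?a) x"
      by (simp add: inner_adjoint[OF assms, symmetric] norm_eq_sqrt_inner)
    also have "\<dots> \<le> norm (f ?a) * norm x"
      by (rule norm_cauchy_schwarz)
    also have "\<dots> \<le> norm ?a * K * norm x"
      by (intro mult_right_mono K) simp
    finally show "norm ?a \<le> norm x * K"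
      by (cases "norm ?a = 0") (use K in \<open>auto simp: mult.assoc mult.commute[of K]\<close>)
  qed
qed

lemma op_nonpos_plus_adjointD:
  fixes \<Phi> :: "'a::{real_inner, complete_space} \<Rightarrow> 'a"
  assumes "bounded_linear \<Phi>" "op_nonpos (\<lambda>w. \<Phi> w + adjoint \<Phi> w)"
  shows "inner w (\<Phi> w) \<le> 0"
proof -
  have "inner w (\<Phi> w) + inner (\<Phi> w) w \<le> 0"
    using assms(2)[unfolded op_nonpos_def op_nonneg_def, rule_format, of w]
    by (simp add: inner_diff_right inner_adjoint[OF assms(1)])
  then show ?thesis by (simp add: inner_commute)
qed

section \<open>Matrices acting on tuples\<close>

lemma coord_mat_op:
  "i < LENGTH('p) \<Longrightarrow> coord (fst (mat_op A u :: ('p::len0, 0) rl2)) i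
     = (\<Sum>j<LENGTH('m). A $$ (i, j) * coord (fst (u :: ('m::len0, 0) rl2)) j)"
  by (simp add: mat_op_def coord_mk_tuple)

lemma rl2_0_eqI:
  fixes u v :: "('m::len0, 0) rl2"
  assumes "\<And>i. i < LENGTH('m) \<Longrightarrow> coord (fst u) i = coord (fst v) i"
  shows "u = v"
  using assms by (intro prod_eqI tuple_eqI) auto

lemma bounded_linear_mat_op: "bounded_linear (mat_op A :: ('m::len0, 0) rl2 \<Rightarrow> ('p::len0, 0) rl2)"
  unfolding mat_op_def
  by (intro bounded_linear_Pair bounded_linear_mk_tuple bounded_linear_sum bounded_linear_const_mult
      bounded_linear_compose[OF bounded_linear_coord] bounded_linear_fst bounded_linear_zero)

lemma mat_op_mult:
  fixes u :: "('m::len0, 0) rl2"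
  assumes "A \<in> carrier_mat LENGTH('p) LENGTH('k)" "B \<in> carrier_mat LENGTH('k) LENGTH('m)"
  shows "(mat_op (A * B) u :: ('p::len0, 0) rl2) = mat_op A (mat_op B u :: ('k::len0, 0) rl2)"
proof (rule rl2_0_eqI)
  fix i assume i: "i < LENGTH('p)"
  have "coord (fst (mat_op (A * B) u :: ('p, 0) rl2)) i =
      (\<Sum>j<LENGTH('m). (\<Sum>k<LENGTH('k). A $$ (i, k) * B $$ (k, j)) * coord (fst u) j)"
    using assms i
    by (simp add: coord_mat_op scalar_prod_def atLeast0LessThan)
  also have "\<dots> = (\<Sum>k<LENGTH('k). A $$ (i, k) * (\<Sum>j<LENGTH('m). B $$ (k, j) * coord (fst u) j))"
    unfolding sum_distrib_left sum_distrib_right mult.assoc by (rule sum.swap)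
  also have "\<dots> = coord (fst (mat_op A (mat_op B u :: ('k, 0) rl2) :: ('p, 0) rl2)) i"
    using i by (simp add: coord_mat_op)
  finally show "coord (fst (mat_op (A * B) u :: ('p, 0) rl2)) i
    = coord (fst (mat_op A (mat_op B u :: ('k, 0) rl2) :: ('p, 0) rl2)) i" .
qed

text \<open>
  The operator \<^const>\<open>mat_inverse\<close> has an optional result. Injectivity excludes the value
  \<^const>\<open>None\<close>, because a square matrix with zero determinant has a nonzero kernel vector.
\<close>

lemma mult_mat_inverse_if_injective:
  assumes F: "F \<in> carrier_mat LENGTH('u::len0) LENGTH('u)"
    and inj: "\<And>u :: ('u, 0) rl2. (mat_op F u :: ('u, 0) rl2) = 0 \<Longrightarrow> u = 0"
  shows "the (mat_inverse F) \<in> carrier_mat LENGTH('u) LENGTH('u)"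
    and "F * the (mat_inverse F) = 1\<^sub>m LENGTH('u)"
proof -
  have "Determinant.det F \<noteq> 0"
  proof
    assume "Determinant.det F = 0"
    then obtain v where v: "v \<in> carrier_vec LENGTH('u)" "v \<noteq> 0\<^sub>v LENGTH('u)" "F *\<^sub>v v = 0\<^sub>v LENGTH('u)"
      using det_0_iff_vec_prod_zero_field[OF F] by auto
    define u :: "('u, 0) rl2" where "u = (mk_tuple (vec_index v), 0)"
    have "(mat_op F u :: ('u, 0) rl2) = 0"
    proof (rule rl2_0_eqI)
      fix i assume i: "i < LENGTH('u)"
      have "coord (fst (mat_op F u :: ('u, 0) rl2)) i = (F *\<^sub>v v) $ i"
        using F v(1) i by (simp add: coord_mat_op u_def coord_mk_tuple scalar_prod_def atLeast0LessThan)
      then show "coord (fst (mat_op F u :: ('u, 0) rl2)) i = coord (fst (0 :: ('u, 0) rl2)) i"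
        using v(3) i by (simp add: zero_tuple.rep_eq)
    qed
    then have "u = 0" by (rule inj)
    then have "v $ i = 0" if "i < LENGTH('u)" for i
      using that coord_mk_tuple[of "vec_index v" i, where 'n='u]
      by (simp add: u_def zero_prod_def zero_tuple.rep_eq)
    then have "v = 0\<^sub>v LENGTH('u)"
      using v(1) by (intro eq_vecI) auto
    with v(2) show False by simp
  qed
  then have "F \<in> Units (ring_mat TYPE(real) LENGTH('u) ())"
    by (rule det_non_zero_imp_unit[OF F])
  then obtain G where "mat_inverse F = Some G"
    using mat_inverse(1)[OF F, of "()"] by (cases "mat_inverse F") auto
  with mat_inverse(2)[OF F this]
  show "the (mat_inverse F) \<in> carrier_mat LENGTH('u) LENGTH('u)"
    and "F * the (mat_inverse F) = 1\<^sub>m LENGTH('u)"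
    by auto
qed

section \<open>Exponential decay from the matrix inequality\<close>

lemma pi_operator_bounded_linear: "pi_operator \<P> \<Longrightarrow> bounded_linear \<P>"
  by (simp add: pi_operator_def)

lemma bounded_linear_Phi_op:
  assumes "bounded_linear \<T>" "bounded_linear \<A>" "bounded_linear \<B>" "bounded_linear \<C>"
    "bounded_linear \<K>" "bounded_linear \<P>"
  shows "bounded_linear (Phi_op \<T> \<A> \<B> \<C> \<K> \<P> F Z \<alpha> \<epsilon>)"
  unfolding Phi_op_def split_def
  by (intro bounded_linear_Pair bounded_linear_add bounded_linear_sub bounded_linear_minus
      bounded_linear_const_scaleR bounded_linear_compose[OF bounded_linear_mat_op]
      assms(1,3)[THEN bounded_linear_adjoint, THEN bounded_linear_compose]
      assms[THEN bounded_linear_compose] bounded_linear_fst bounded_linear_snd)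

text \<open>
  The adjoints \<open>\<B>\<^sup>*\<close> and \<open>\<T>\<^sup>*\<close> are moved to the other side of the inner product, so that
  \<open>\<B> u\<close> and \<open>\<B> (\<K> z)\<close> can be combined.
\<close>

lemma inner_Phi_op:
  assumes "bounded_linear \<T>" "bounded_linear \<B>"
  shows "inner (u, z) (Phi_op \<T> \<A> \<B> \<C> \<K> \<P> F Z \<alpha> \<epsilon> (u, z)) =
    inner u (mat_op Z (\<C> z) - mat_op F (\<K> z) - mat_op F u) + \<epsilon> / 2 * (norm u)\<^sup>2
    + inner (\<B> u) (\<P> (\<T> z)) + inner (\<T> z) (\<P> (\<A> z + \<B> (\<K> z) + \<alpha> *\<^sub>R \<T> z))"
  by (simp add: Phi_op_def inner_adjoint[OF assms(1)] inner_adjoint[OF assms(2)] inner_simps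
      power2_norm_eq_inner)

text \<open>
  The function \<open>V t * exp (c * t)\<close> has a nonpositive derivative, so by the mean value theorem it stays
  below its initial value.
\<close>

lemma gronwall_decay:
  fixes V V' :: "real \<Rightarrow> real"
  assumes deriv: "\<And>t. t \<ge> 0 \<Longrightarrow> (V has_real_derivative V' t) (at t within {0..})"
    and le: "\<And>t. t \<ge> 0 \<Longrightarrow> V' t \<le> - c * V t"
    and t: "t \<ge> 0"
  shows "V t \<le> V 0 * exp (- c * t)"
proof (cases "t = 0")
  case False
  define W where "W s = V s * exp (c * s)" for s
  have W: "(W has_derivative (\<lambda>h. h * ((V' s + c * V s) * exp (c * s)))) (at s within {0..t})"
    if "s \<in> {0..t}" for s
  proof -
    have "(V has_real_derivative V' s) (at s within {0..t})"
      using deriv[of s] that by (auto intro: has_field_derivative_subset)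
    then have "(W has_real_derivative ((V' s + c * V s) * exp (c * s))) (at s within {0..t})"
      unfolding W_def by (auto intro!: derivative_eq_intros simp: algebra_simps)
    then show ?thesis
      by (simp add: has_field_derivative_def mult.commute[of _ "_ * exp _"])
  qed
  obtain s where s: "s \<in> {0<..<t}" and eq: "W t - W 0 = (t - 0) * ((V' s + c * V s) * exp (c * s))"
    using mvt_simple[of 0 t W, OF _ W] False t by force
  have "(V' s + c * V s) * exp (c * s) \<le> 0"
    using le[of s] s by (simp add: mult_le_0_iff)
  then have "W t \<le> W 0"
    using eq t by (smt (verit) mult_nonneg_nonpos)
  then show ?thesis
    by (simp add: W_def exp_minus field_simps)
qed simp

text \<open>
  Lyapunov's method for an equation that governs \<open>\<T> x\<close> instead of \<open>x\<close>. Along a solution the quadratic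
  form of \<open>\<P>\<close> at \<open>\<T> x\<close> decays at rate \<open>2 \<alpha>\<close>, and the norm, of the order of its square root, at rate \<open>\<alpha>\<close>.
\<close>

lemma exp_stable_if_lyapunov:
  fixes \<T> \<G> \<P> :: "'a::real_inner \<Rightarrow> 'a"
  assumes P: "bounded_linear \<P>"
    and sym: "\<And>x y. inner x (\<P> y) = inner (\<P> x) y"
    and coercive: "\<And>z. \<delta> * (norm z)\<^sup>2 \<le> inner z (\<P> z)"
    and "\<delta> > 0" "\<alpha> > 0"
    and diss: "\<And>z. inner (\<T> z) (\<P> (\<G> z)) \<le> - \<alpha> * inner (\<T> z) (\<P> (\<T> z))"
  shows "exp_stable \<T> \<G> \<alpha>"
proof -
  obtain K where K: "K \<ge> 0" "\<And>x. norm (\<P> x) \<le> norm x * K"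
    using bounded_linear.nonneg_bounded[OF P] by blast
  have bound: "norm (\<T> (x t)) \<le> sqrt (K / \<delta>) * norm (\<T> (x 0)) * exp (- \<alpha> * t)"
    if x: "pie_solution \<T> \<G> x" and t: "t \<ge> 0" for x t
  proof -
    define y where "y \<tau> = \<T> (x \<tau>)" for \<tau>
    define V where "V \<tau> = inner (y \<tau>) (\<P> (y \<tau>))" for \<tau>
    define V' where "V' \<tau> = 2 * inner (y \<tau>) (\<P> (\<G> (x \<tau>)))" for \<tau>
    have "(V has_real_derivative V' \<tau>) (at \<tau> within {0..})" if "\<tau> \<ge> 0" for \<tau>
    proof -
      have y: "(y has_derivative (\<lambda>h. h *\<^sub>R \<G> (x \<tau>))) (at \<tau> within {0..})"
        using x that unfolding pie_solution_def y_def has_vector_derivative_def by auto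
      have "(V has_derivative (\<lambda>h. inner (y \<tau>) (\<P> (h *\<^sub>R \<G> (x \<tau>))) + inner (h *\<^sub>R \<G> (x \<tau>)) (\<P> (y \<tau>))))
          (at \<tau> within {0..})"
        unfolding V_def
        by (intro has_derivative_inner y bounded_linear.has_derivative[OF P])
      moreover have "inner (y \<tau>) (\<P> (h *\<^sub>R \<G> (x \<tau>))) + inner (h *\<^sub>R \<G> (x \<tau>)) (\<P> (y \<tau>)) = V' \<tau> * h" for h
        using sym[of "y \<tau>" "\<G> (x \<tau>)"] sym[of "\<G> (x \<tau>)" "y \<tau>"]
        by (simp add: V'_def linear_simps(5)[OF P] inner_commute)
      ultimately show ?thesis
        by (simp add: has_field_derivative_def)
    qed
    moreover have "V' \<tau> \<le> - (2 * \<alpha>) * V \<tau>" for \<tau>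
      using diss[of "x \<tau>"] by (simp add: V_def V'_def y_def)
    ultimately have "V t \<le> V 0 * exp (- (2 * \<alpha>) * t)"
      using gronwall_decay[of V V' "2 * \<alpha>" t] t by blast
    moreover have "V 0 \<le> K * (norm (y 0))\<^sup>2"
    proof -
      have "V 0 \<le> norm (y 0) * norm (\<P> (y 0))"
        unfolding V_def by (rule norm_cauchy_schwarz)
      also have "\<dots> \<le> norm (y 0) * (norm (y 0) * K)"
        by (intro mult_left_mono K) simp
      finally show ?thesis by (simp add: power2_eq_square mult_ac)
    qed
    ultimately have "V t \<le> K * (norm (y 0))\<^sup>2 * exp (- (2 * \<alpha>) * t)"
      by (smt (verit) exp_ge_zero mult_right_mono)
    moreover have "exp (- (2 * \<alpha>) * t) = (exp (- \<alpha> * t))\<^sup>2"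
      by (simp flip: exp_double)
    ultimately have "\<delta> * (norm (y t))\<^sup>2 \<le> K * (norm (y 0))\<^sup>2 * (exp (- \<alpha> * t))\<^sup>2"
      using coercive[of "y t"] by (simp add: V_def)
    then have "(norm (y t))\<^sup>2 \<le> (sqrt (K / \<delta>) * norm (y 0) * exp (- \<alpha> * t))\<^sup>2"
      using \<open>\<delta> > 0\<close> K(1) by (simp add: power_mult_distrib field_simps)
    then have "norm (y t) \<le> sqrt (K / \<delta>) * norm (y 0) * exp (- \<alpha> * t)"
      by (rule power2_le_imp_le) (use K(1) \<open>\<delta> > 0\<close> in simp)
    then show ?thesis
      by (simp add: y_def)
  qed
  show ?thesis
    unfolding exp_stable_def using \<open>\<alpha> > 0\<close> bound by (intro conjI exI[of _ "sqrt (K / \<delta>)"]) auto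
qed

theorem theorem11:
  fixes \<T> \<A> \<P> :: "('m::len0, 'n::len0) rl2 \<Rightarrow> ('m, 'n) rl2"
    and \<B> :: "('u::len0, 0) rl2 \<Rightarrow> ('m, 'n) rl2"
    and \<C> :: "('m, 'n) rl2 \<Rightarrow> ('y::len0, 0) rl2"
    and \<K> :: "('m, 'n) rl2 \<Rightarrow> ('u, 0) rl2"
    and F Z L :: "real mat"
    and \<alpha> \<delta> \<epsilon> :: real
  assumes "pi_operator \<T>" and "pi_operator \<A>" and "pi_operator \<B>"
    and "pi_operator \<C>" and "pi_operator \<K>"
    and "pi_operator \<P>" and "\<P> = adjoint \<P>"
    and "F \<in> carrier_mat LENGTH('u) LENGTH('u)" and "Z \<in> carrier_mat LENGTH('u) LENGTH('y)"
    and "\<alpha> > 0" and "\<delta> > 0" and "\<epsilon> > 0"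
    and "op_nonneg (\<lambda>z. \<P> z - \<delta> *\<^sub>R z)"
    and "op_nonpos (\<lambda>w. Phi_op \<T> \<A> \<B> \<C> \<K> \<P> F Z \<alpha> \<epsilon> w +
           adjoint (Phi_op \<T> \<A> \<B> \<C> \<K> \<P> F Z \<alpha> \<epsilon>) w)"
    and "L = the (mat_inverse F) * Z"
  shows "exp_stable \<T> (\<lambda>z. \<A> z + \<B> (mat_op L (\<C> z))) \<alpha>"
proof -
  note bl = assms(1-6)[THEN pi_operator_bounded_linear]
  have lmi: "inner (u, z) (Phi_op \<T> \<A> \<B> \<C> \<K> \<P> F Z \<alpha> \<epsilon> (u, z)) \<le> 0" for u z
    by (rule op_nonpos_plus_adjointD[OF bounded_linear_Phi_op[OF bl] assms(14)])
  have F_coercive: "\<epsilon> / 2 * (norm u)\<^sup>2 \<le> inner u (mat_op F u)" for u :: "('u, 0) rl2"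
    using lmi[of u 0] bl
    by (simp add: inner_Phi_op bounded_linear_mat_op linear_simps inner_simps)
  have F_inj: "u = 0" if "(mat_op F u :: ('u, 0) rl2) = 0" for u :: "('u, 0) rl2"
    using F_coercive[of u] that \<open>\<epsilon> > 0\<close> by (simp add: mult_le_0_iff)
  note inv = mult_mat_inverse_if_injective[OF assms(8) F_inj]
  have L: "L \<in> carrier_mat LENGTH('u) LENGTH('y)"
    using inv(1) assms(9,15) by auto
  have "F * L = Z"
    using assoc_mult_mat[OF assms(8) inv(1) assms(9)] inv(2) assms(9,15) by simp
  then have ZFL: "mat_op Z v = (mat_op F (mat_op L v :: ('u, 0) rl2) :: ('u, 0) rl2)"
    for v :: "('y, 0) rl2"
    using mat_op_mult[OF assms(8) L] by metis
  have sym: "inner x (\<P> y) = inner (\<P> x) y" for x y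
    using inner_adjoint[OF bl(6)] assms(7) by metis
  show ?thesis
  proof (rule exp_stable_if_lyapunov[OF bl(6) sym _ \<open>\<delta> > 0\<close> \<open>\<alpha> > 0\<close>])
    show "\<delta> * (norm z)\<^sup>2 \<le> inner z (\<P> z)" for z
      using assms(13)[unfolded op_nonneg_def, rule_format, of z]
      by (simp add: inner_diff_right power2_norm_eq_inner)
    fix z
    \<comment> \<open>With this \<open>u\<close> the terms with \<open>F\<close> and \<open>Z\<close> cancel, as \<open>Z = F L\<close>.\<close>
    define u where "u = mat_op L (\<C> z) - \<K> z"
    have "mat_op Z (\<C> z) - mat_op F (\<K> z) - mat_op F u = (0 :: ('u, 0) rl2)"
      by (simp add: u_def ZFL linear_simps[OF bounded_linear_mat_op])
    moreover have "inner (\<B> u) (\<P> (\<T> z)) = inner (\<T> z) (\<P> (\<B> u))"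
      using sym[of "\<T> z" "\<B> u"] by (simp add: inner_commute)
    moreover have "0 \<le> \<epsilon> / 2 * (norm u)\<^sup>2"
      using \<open>\<epsilon> > 0\<close> by simp
    ultimately have "inner (\<T> z) (\<P> (\<B> u)) + inner (\<T> z) (\<P> (\<A> z + \<B> (\<K> z) + \<alpha> *\<^sub>R \<T> z)) \<le> 0"
      using lmi[of u z] unfolding inner_Phi_op[OF bl(1,3)] by simp
    then show "inner (\<T> z) (\<P> (\<A> z + \<B> (mat_op L (\<C> z)))) \<le> - \<alpha> * inner (\<T> z) (\<P> (\<T> z))"
      by (simp add: u_def linear_simps[OF bl(6)] linear_simps[OF bl(3)] inner_simps)
  qed
qed

end
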